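(* Let $d,b\in\mathbb{N}$, $\epsilon>0$, $\lambda\in[0,1)$ with $b\ge \log_2\!\left(\frac{2d}{\epsilon}\cdot\frac{1+\lambda}{1-\lambda}\right)$. Given query access to a $\lambda$-contraction grid-map $f:G^d_b\to[0,1]^d$ (with respect to the $\ell_1$-norm), a point $x\in G^d_b$ with $\|f(x)-x\|_1\le\epsilon$ can be found using $\mathcal{O}\!\left(d^2\left(\log\frac{1}{\epsilon}+\log\frac{1}{1-\lambda}\right)\right)$ queries to $f$ (all queries being points of $G^d_b$).
   Context: For an integer $b\ge1$, the grid $G^d_b\subseteq[0,1]^d$ is the set of points $x$ with $x_i=k_i/2^b$ for integers $k_i\in\{0,1,\dots,2^b\}$, $i\in[d]$. A function $f:G^d_b\to[0,1]^d$ is a $\lambda$-contraction grid-map (w.r.t. $\ell_1$) if there exists $f':[0,1]^d\to[0,1]^d$ with $\|f'(x)-f'(y)\|_1\le\lambda\|x-y\|_1$ for all $x,y\in[0,1]^d$ and $f(x)=f'(x)$ for all $x\in G^d_b$. Here $\|x\|_1=\sum_i|x_i|$. A query consists of choosing a grid point $x$ and receiving $f(x)$.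
   Formalization: Since log(1/ε)+log(1/(1-λ)) can be zero or negative for ε ≥ 1 (e.g. ε=1, λ=0, d=3, where a query is needed), the bound proved is C·max(1, d²(max(0, log(1/ε)) + log(1/(1-λ)))) with an absolute constant C; d ≥ 1 is assumed. *)

theory Defs
  imports Complex_Main "HOL-Library.FuncSet"
begin

text \<open>
  A point of \<open>\<real>\<^sup>d\<close> is an extensional function on the index set \<open>{..<d}\<close>, so that the
  dimension \<open>d\<close> can be quantified inside a formula.
\<close>

definition l1_norm :: "nat \<Rightarrow> (nat \<Rightarrow> real) \<Rightarrow> real" where
  "l1_norm d x = (\<Sum>i<d. \<bar>x i\<bar>)"

definition cube :: "nat \<Rightarrow> (nat \<Rightarrow> real) set" where
  "cube d = {..<d} \<rightarrow>\<^sub>E {0..1}"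

definition grid :: "nat \<Rightarrow> nat \<Rightarrow> (nat \<Rightarrow> real) set" where
  "grid d b = {x \<in> cube d. \<forall>i<d. \<exists>k::nat. k \<le> 2 ^ b \<and> x i = real k / 2 ^ b}"

definition contraction_grid_map ::
    "nat \<Rightarrow> nat \<Rightarrow> real \<Rightarrow> ((nat \<Rightarrow> real) \<Rightarrow> (nat \<Rightarrow> real)) \<Rightarrow> bool" where
  "contraction_grid_map d b lam f \<longleftrightarrow>
     f \<in> grid d b \<rightarrow> cube d \<and>
     (\<exists>f'. f' \<in> cube d \<rightarrow> cube d \<and>
           (\<forall>x\<in>cube d. \<forall>y\<in>cube d.
              l1_norm d (\<lambda>i. f' x i - f' y i) \<le> lam * l1_norm d (\<lambda>i. x i - y i)) \<and>
           (\<forall>x\<in>grid d b. f x = f' x))"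

text \<open>
  Deterministic adaptive query algorithms as decision trees: a node either outputs a
  result or queries the oracle at a point and continues depending on the answer.  The
  tree is fixed independently of the oracle, which influences a run only through the
  answers to the queries.
\<close>

datatype ('q, 'r, 'o) query_alg =
    Output 'o
  | Query 'q "'r \<Rightarrow> ('q, 'r, 'o) query_alg"

primrec result :: "('q, 'r, 'o) query_alg \<Rightarrow> ('q \<Rightarrow> 'r) \<Rightarrow> 'o" where
  "result (Output x) f = x"
| "result (Query q k) f = result (k (f q)) f"

primrec queries :: "('q, 'r, 'o) query_alg \<Rightarrow> ('q \<Rightarrow> 'r) \<Rightarrow> 'q list" where
  "queries (Output x) f = []"
| "queries (Query q k) f = q # queries (k (f q)) f"

end

theory Submission
  imports Defs "HOL-Analysis.Brouwer_Fixpoint"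
begin

text \<open>
  If \<open>c\<close> is queried with answer \<open>y\<close> and the residual exceeds \<open>\<epsilon>\<close>, then the fixpoint, and also a
  fixed grid point \<open>z\<close> near it, is strictly closer to \<open>y\<close> than to \<open>c\<close>.  It therefore suffices to
  choose \<open>c\<close> such that, whatever \<open>y\<close> is, at most a fraction \<open>d / (d + 1)\<close> of the remaining
  candidates is closer to \<open>y\<close> than to \<open>c\<close>.

  If no grid point were such an \<open>\<ell>\<^sub>1\<close>-centerpoint, every grid point \<open>x\<close> would carry a direction
  \<open>V x\<close> that approaches more than a fraction \<open>d / (d + 1)\<close> of the candidates.  The \<open>d + 1\<close> vertices
  of a simplex of the Kuhn triangulation then approach a common candidate, and the sign vector
  towards it has positive inner product with all their directions.  So the piecewise linear
  interpolation of \<open>V\<close> would be an inward pointing field without zeros, contradicting Kuhn's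
  lemma.

  Counting candidates on the coarsest admissible grid gives
  \<open>O(d\<^sup>2 (log d + log (1 / \<epsilon>) + log (1 / (1 - \<lambda>))))\<close> queries.  The term \<open>log d\<close> is absorbed when
  \<open>d \<le> 1 / (1 - \<lambda>)\<close> and \<open>\<lambda> \<ge> 1 / 2\<close>; otherwise rounded Banach iteration is fast enough.
\<close>

section \<open>Centerpoints for the \<open>\<ell>\<^sub>1\<close>-norm\<close>

definition box_pts :: "nat \<Rightarrow> nat \<Rightarrow> (nat \<Rightarrow> nat) set" where
  "box_pts d p = {..<d} \<rightarrow>\<^sub>E {..p}"

text \<open>As \<open>t\<close> runs through \<open>{..<m}\<close>, the carries out of
  \<open>X i mod m + t\<close> produce the vertices of the Kuhn simplex containing
  \<open>X / m\<close>, each as often as \<open>m\<close> times its barycentric coordinate.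
  Simplices thus never have to be named.\<close>

definition coarsen :: "nat \<Rightarrow> nat \<Rightarrow> (nat \<Rightarrow> nat) \<Rightarrow> nat \<Rightarrow> nat \<Rightarrow> nat" where
  "coarsen d m X t = (\<lambda>i\<in>{..<d}. (X i + t) div m)"

lemma finite_box_pts: "finite (box_pts d p)"
  by (simp add: box_pts_def finite_PiE)

lemma coarsen_in_box_pts:
  assumes "\<forall>i<d. X i \<le> p * m" "t < m"
  shows "coarsen d m X t \<in> box_pts d p"
proof -
  have "(X i + t) div m \<le> p" if "i < d" for i
  proof -
    have "X i + t < Suc p * m" using assms that by auto
    then show ?thesis by (simp add: less_mult_imp_div_less less_Suc_eq_le[symmetric])
  qed
  then show ?thesis by (simp add: coarsen_def box_pts_def)
qed

lemma coarsen_mono: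
  assumes "s \<le> t" "i < d"
  shows "coarsen d m X s i \<le> coarsen d m X t i"
  using assms by (simp add: coarsen_def div_le_mono)

lemma coarsen_bounds:
  assumes "t < m" "i < d"
  shows "X i div m \<le> coarsen d m X t i" "coarsen d m X t i \<le> X i div m + 1"
proof -
  show "X i div m \<le> coarsen d m X t i"
    using assms by (simp add: coarsen_def div_le_mono)
  have "(X i + t) div m \<le> (X i + m) div m"
    using assms by (intro div_le_mono) simp
  then show "coarsen d m X t i \<le> X i div m + 1"
    using assms by (simp add: coarsen_def)
qed

text \<open>The values form a chain in the unit cell at \<open>X div m\<close>, so their coordinate sums tell
  them apart.\<close>
lemma card_coarsen_image_le: "card (coarsen d m X ` {..<m}) \<le> d + 1"
proof -
  let ?S = "\<lambda>g::nat \<Rightarrow> nat. \<Sum>i<d. g i"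
  let ?Q = "\<Sum>i<d. X i div m"
  have eq: "coarsen d m X s = coarsen d m X t"
    if "s \<le> t" "?S (coarsen d m X s) = ?S (coarsen d m X t)" for s t
  proof
    fix i
    show "coarsen d m X s i = coarsen d m X t i"
    proof (cases "i < d")
      case True
      show ?thesis
        by (rule sum_mono_inv[OF that(2)]) (use True coarsen_mono[OF that(1)] in auto)
    qed (simp add: coarsen_def)
  qed
  have "inj_on ?S (coarsen d m X ` {..<m})"
  proof (rule inj_onI)
    fix g h
    assume "g \<in> coarsen d m X ` {..<m}" "h \<in> coarsen d m X ` {..<m}" and S: "?S g = ?S h"
    then obtain s t where g: "g = coarsen d m X s" and h: "h = coarsen d m X t" by blast
    show "g = h"
    proof (cases "s \<le> t")
      case True
      then show ?thesis using eq S unfolding g h by blast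
    next
      case False
      then have "t \<le> s" by simp
      then show ?thesis using eq[OF _ S[symmetric, unfolded g h]] unfolding g h by simp
    qed
  qed
  moreover have "?S ` (coarsen d m X ` {..<m}) \<subseteq> {?Q..?Q + d}"
  proof clarsimp
    fix t assume t: "t < m"
    have "?S (coarsen d m X t) \<le> (\<Sum>i<d. X i div m + 1)"
      by (intro sum_mono coarsen_bounds(2)[OF t]) simp
    also have "\<dots> = ?Q + d" by (simp only: sum.distrib) simp
    finally show "?Q \<le> ?S (coarsen d m X t) \<and> ?S (coarsen d m X t) \<le> ?Q + d"
      using t by (auto intro: sum_mono coarsen_bounds(1))
  qed
  ultimately have "card (coarsen d m X ` {..<m}) \<le> card {?Q..?Q + d}"
    by (intro card_inj_on_le) auto
  then show ?thesis by simp
qed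

text \<open>Raising \<open>X j\<close> by one changes its quotient for a single shift
  \<open>t\<close> only, the one just short of a carry. So each coordinate spoils at most one shift;
  this makes the interpolation Lipschitz.\<close>

lemma card_coarsen_neq_le:
  assumes r: "\<forall>j<d. X j \<le> r j \<and> r j \<le> X j + 1"
  shows "card {t. t < m \<and> coarsen d m X t \<noteq> coarsen d m r t} \<le> d"
proof -
  have "{t. t < m \<and> coarsen d m X t \<noteq> coarsen d m r t} \<subseteq> (\<lambda>j. m - 1 - X j mod m) ` {..<d}"
  proof clarsimp
    fix t assume t: "t < m" and ne: "coarsen d m X t \<noteq> coarsen d m r t"
    obtain j where j: "j < d" "(X j + t) div m \<noteq> (r j + t) div m"
    proof (rule ccontr)
      assume "\<not> thesis"
      then have "\<And>j. j < d \<Longrightarrow> (X j + t) div m = (r j + t) div m" using that by blast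
      then have "coarsen d m X t = coarsen d m r t" by (auto simp: coarsen_def)
      with ne show False by simp
    qed
    then have "r j = Suc (X j)" using r by (metis Suc_eq_plus1 le_antisym not_less_eq_eq)
    with j have "Suc (X j + t) mod m = 0" by (auto simp: div_Suc split: if_splits)
    then have "(X j mod m + t + 1) mod m = 0"
      by (metis Suc_eq_plus1 add.assoc mod_add_left_eq)
    \<comment> \<open>The left side lies strictly between \<open>0\<close> and \<open>2 * m\<close>,
      so the only multiple of \<open>m\<close> it can be is \<open>m\<close> itself.\<close>
    then obtain c where c: "X j mod m + t + 1 = m * c" by (auto simp: mod_eq_0_iff_dvd)
    have "X j mod m < m" using t by simp
    then have "m * c < m * 2" using c t by linarith
    then have "c < 2" by simp
    moreover have "c \<noteq> 0" using c by (cases c) auto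
    ultimately have "c = 1" by simp
    then have "t = m - 1 - X j mod m" using c by simp
    then show "t \<in> (\<lambda>j. m - Suc (X j mod m)) ` {..<d}" using j by auto
  qed
  then have "card {t. t < m \<and> coarsen d m X t \<noteq> coarsen d m r t}
      \<le> card ((\<lambda>j. m - 1 - X j mod m) ` {..<d})"
    by (intro card_mono) auto
  also have "\<dots> \<le> d" using card_image_le[of "{..<d}"] by simp
  finally show ?thesis .
qed

text \<open>The average of \<open>V (coarsen d m X t)\<close> over \<open>t < m\<close> is the piecewise linear interpolation
  of \<open>V\<close> on the Kuhn triangulation, evaluated at \<open>X / m\<close>.\<close>
lemma inward_field_approx_zero:
  fixes V :: "(nat \<Rightarrow> nat) \<Rightarrow> nat \<Rightarrow> real"
  assumes p: "0 < p" and \<delta>: "0 < \<delta>"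
    and bnd: "\<And>x i. x \<in> box_pts d p \<Longrightarrow> i < d \<Longrightarrow> \<bar>V x i\<bar> \<le> B"
    and lo: "\<And>x i. x \<in> box_pts d p \<Longrightarrow> i < d \<Longrightarrow> x i = 0 \<Longrightarrow> 0 \<le> V x i"
    and hi: "\<And>x i. x \<in> box_pts d p \<Longrightarrow> i < d \<Longrightarrow> x i = p \<Longrightarrow> V x i \<le> 0"
  obtains m X where "0 < m" "\<forall>i<d. X i \<le> p * m"
    "\<forall>i<d. \<bar>\<Sum>t<m. V (coarsen d m X t) i\<bar> \<le> real m * \<delta>"
proof -
  \<comment> \<open>Neighbouring lattice points differ in at most \<open>d\<close> summands, each by
    at most \<open>2 * \<bar>B\<bar>\<close>; \<open>m\<close> is taken so large that this stays
    below \<open>m * \<delta>\<close>.\<close>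
  obtain m0 :: nat where m0: "real m0 > 2 * \<bar>B\<bar> * real d / \<delta>" using reals_Archimedean2 by blast
  define m where "m = Suc m0"
  have m: "0 < m" by (simp add: m_def)
  have "2 * \<bar>B\<bar> * real d / \<delta> \<le> real m" using m0 by (simp add: m_def)
  then have mB: "2 * \<bar>B\<bar> * real d \<le> real m * \<delta>" using \<delta> by (simp add: pos_divide_le_eq)
  define F where "F X i = (\<Sum>t<m. V (coarsen d m X t) i)" for X i
  \<comment> \<open>The labels on the faces are forced, as Kuhn's lemma demands. By
    \<open>lo\<close> and \<open>hi\<close> they still agree with a weak sign of \<open>F\<close>,
    which \<open>lab0\<close> and \<open>lab1\<close> record.\<close>
  define lab where
    "lab X i = (if X i = 0 then 0 else if X i = p * m then 1 else if 0 \<le> F X i then 0 else 1 :: nat)"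
    for X i
  have lab0: "0 \<le> F X i" if "\<forall>i<d. X i \<le> p * m" "i < d" "lab X i = 0" for X i
  proof (cases "X i = 0")
    case True
    have "0 \<le> V (coarsen d m X t) i" if "t < m" for t
      using lo[OF coarsen_in_box_pts] \<open>\<forall>i<d. X i \<le> p * m\<close> \<open>i < d\<close> that True
      by (simp add: coarsen_def)
    then show ?thesis by (auto simp: F_def intro: sum_nonneg)
  qed (use that in \<open>auto simp: lab_def split: if_splits\<close>)
  have lab1: "F X i \<le> 0" if "\<forall>i<d. X i \<le> p * m" "i < d" "lab X i \<noteq> 0" for X i
  proof (cases "X i = p * m")
    case True
    have "V (coarsen d m X t) i \<le> 0" if "t < m" for t
      using hi[OF coarsen_in_box_pts] \<open>\<forall>i<d. X i \<le> p * m\<close> \<open>i < d\<close> that True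
      by (simp add: coarsen_def)
    then show ?thesis by (auto simp: F_def intro: sum_nonpos)
  qed (use that in \<open>auto simp: lab_def split: if_splits\<close>)
  have lab_cases: "lab X i = 0 \<or> lab X i = 1" for X i by (simp add: lab_def)
  have lip: "\<bar>F X i - F r i\<bar> \<le> real m * \<delta>"
    if X: "\<forall>i<d. X i \<le> p * m" and r: "\<forall>i<d. r i \<le> p * m"
      and Xr: "\<forall>j<d. X j \<le> r j \<and> r j \<le> X j + 1" and i: "i < d" for X r i
  proof -
    let ?D = "{t. t < m \<and> coarsen d m X t \<noteq> coarsen d m r t}"
    have "\<bar>F X i - F r i\<bar> \<le> (\<Sum>t<m. \<bar>V (coarsen d m X t) i - V (coarsen d m r t) i\<bar>)"
      by (simp add: F_def sum_subtractf[symmetric] sum_abs)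
    also have "\<dots> = (\<Sum>t\<in>?D. \<bar>V (coarsen d m X t) i - V (coarsen d m r t) i\<bar>)"
      by (rule sum.mono_neutral_right) auto
    also have "\<dots> \<le> (\<Sum>t\<in>?D. 2 * \<bar>B\<bar>)"
    proof (rule sum_mono)
      fix t assume "t \<in> ?D"
      then have "\<bar>V (coarsen d m X t) i\<bar> \<le> B" "\<bar>V (coarsen d m r t) i\<bar> \<le> B"
        using bnd coarsen_in_box_pts X r i by auto
      then show "\<bar>V (coarsen d m X t) i - V (coarsen d m r t) i\<bar> \<le> 2 * \<bar>B\<bar>" by linarith
    qed
    also have "\<dots> = real (card ?D) * (2 * \<bar>B\<bar>)" by simp
    also have "\<dots> \<le> real d * (2 * \<bar>B\<bar>)"
      using card_coarsen_neq_le[OF Xr] by (intro mult_right_mono) auto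
    finally show ?thesis using mB by (simp add: mult_ac)
  qed
  have "0 < p * m" using p m by simp
  then obtain q where q: "\<forall>i<d. q i < p * m"
    and qrs: "\<forall>i<d. \<exists>r s. (\<forall>j<d. q j \<le> r j \<and> r j \<le> q j + 1)
        \<and> (\<forall>j<d. q j \<le> s j \<and> s j \<le> q j + 1) \<and> lab r i \<noteq> lab s i"
    by (rule kuhn_lemma[where label = lab and n = d]) (use p m in \<open>auto simp: lab_def\<close>)
  have q': "\<forall>i<d. q i \<le> p * m" using q by auto
  have "\<bar>F q i\<bar> \<le> real m * \<delta>" if i: "i < d" for i
  proof -
    obtain r s where r: "\<forall>j<d. q j \<le> r j \<and> r j \<le> q j + 1"
      and s: "\<forall>j<d. q j \<le> s j \<and> s j \<le> q j + 1" and rs: "lab r i \<noteq> lab s i"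
      using qrs i by blast
    have r': "\<forall>j<d. r j \<le> p * m" and s': "\<forall>j<d. s j \<le> p * m" using q r s
      by (metis Suc_eq_plus1 Suc_leI le_trans)+
    \<comment> \<open>Different labels mean weakly opposite signs at two corners of one cell, so at
      \<open>q\<close> the value is at most one neighbour step away from zero.\<close>
    have "0 \<le> F r i \<and> F s i \<le> 0 \<or> F r i \<le> 0 \<and> 0 \<le> F s i"
      using rs lab0[OF r' i] lab1[OF r' i] lab0[OF s' i] lab1[OF s' i]
      by (metis lab_cases)
    then show ?thesis using lip[OF q' r' r i] lip[OF q' s' s i] by linarith
  qed
  then show thesis using that[OF m q'] by (auto simp: F_def)
qed

text \<open>The negated one-sided derivative at \<open>x\<close>, in direction \<open>v\<close>, of the \<open>\<ell>\<^sub>1\<close>-distance to \<open>z\<close>.\<close>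
definition approach :: "nat \<Rightarrow> (nat \<Rightarrow> nat) \<Rightarrow> (nat \<Rightarrow> real) \<Rightarrow> (nat \<Rightarrow> nat) \<Rightarrow> real" where
  "approach d x v z =
     (\<Sum>i<d. if z i = x i then - \<bar>v i\<bar> else if x i < z i then v i else - v i)"

text \<open>Analogue of the classical centerpoint theorem, with open halfspaces replaced by the sets
  of candidates that a direction \<open>v\<close> approaches.\<close>

lemma l1_centerpoint:
  assumes p: "0 < p" and P: "P \<subseteq> box_pts d p"
  shows "\<exists>x\<in>box_pts d p. \<forall>v. card {z\<in>P. 0 < approach d x v z} * (d + 1) \<le> d * card P"
proof (rule ccontr)
  assume neg: "\<not> ?thesis"
  have finP: "finite P" using P finite_box_pts finite_subset by blast
  define bad where "bad x v \<longleftrightarrow> d * card P < card {z\<in>P. 0 < approach d x v z} * (d + 1)" for x v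
  have "\<exists>v. bad x v \<and> (\<forall>i<d. (x i = 0 \<longrightarrow> 0 \<le> v i) \<and> (x i = p \<longrightarrow> v i \<le> 0))"
    if x: "x \<in> box_pts d p" for x
  proof -
    obtain v where v: "bad x v" using neg x unfolding bad_def by (meson not_le)
    \<comment> \<open>Components pointing out of the box are set to zero. No candidate lies beyond
      the face, so this never lowers \<open>approach\<close>, and the field becomes inward
      pointing.\<close>
    define w where
      "w i = (if x i = 0 \<and> v i < 0 then 0 else if x i = p \<and> 0 < v i then 0 else v i)" for i
    have "approach d x v z \<le> approach d x w z" if "z \<in> P" for z
    proof -
      have "z i \<le> p" if "i < d" for i
        using that \<open>z \<in> P\<close> P by (auto simp: box_pts_def)
      then show ?thesis unfolding approach_def
        by (intro sum_mono) (force simp: w_def)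
    qed
    then have "{z\<in>P. 0 < approach d x v z} \<subseteq> {z\<in>P. 0 < approach d x w z}" by force
    then have "card {z\<in>P. 0 < approach d x v z} \<le> card {z\<in>P. 0 < approach d x w z}"
      using finP by (intro card_mono) auto
    then have "bad x w" using v unfolding bad_def
      by (meson less_le_trans mult_le_mono1)
    moreover have "\<forall>i<d. (x i = 0 \<longrightarrow> 0 \<le> w i) \<and> (x i = p \<longrightarrow> w i \<le> 0)"
      using p by (auto simp: w_def)
    ultimately show ?thesis by blast
  qed
  then obtain V where V: "\<And>x. x \<in> box_pts d p \<Longrightarrow> bad x (V x)"
    and Vlo: "\<And>x i. x \<in> box_pts d p \<Longrightarrow> i < d \<Longrightarrow> x i = 0 \<Longrightarrow> 0 \<le> V x i"
    and Vhi: "\<And>x i. x \<in> box_pts d p \<Longrightarrow> i < d \<Longrightarrow> x i = p \<Longrightarrow> V x i \<le> 0"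
    by metis
  \<comment> \<open>All positive inner products of a sign vector with a value of \<open>V\<close>: a
    finite set, so its minimum bounds them away from zero uniformly. The element \<open>1\<close>
    keeps \<open>Min\<close> meaningful if there are none.\<close>
  define D where "D = insert 1
    ({r. 0 < r} \<inter> (\<lambda>(x, s). \<Sum>i<d. s i * V x i) ` (box_pts d p \<times> ({..<d} \<rightarrow>\<^sub>E {-1, 1})))"
  define \<delta> where "\<delta> = Min D"
  have finD: "finite D" unfolding D_def
    by (intro finite.insertI finite_Int disjI2 finite_imageI finite_cartesian_product
        finite_box_pts finite_PiE) auto
  have \<delta>: "0 < \<delta>" unfolding \<delta>_def using finD by (subst Min_gr_iff) (auto simp: D_def)
  define B where "B = (\<Sum>x\<in>box_pts d p. \<Sum>i<d. \<bar>V x i\<bar>)"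
  have B: "\<bar>V x i\<bar> \<le> B" if "x \<in> box_pts d p" "i < d" for x i
  proof -
    have "\<bar>V x i\<bar> \<le> (\<Sum>i<d. \<bar>V x i\<bar>)"
      using that by (intro member_le_sum) auto
    also have "\<dots> \<le> B" unfolding B_def
      using that finite_box_pts
      by (intro member_le_sum[of x _ "\<lambda>x. \<Sum>i<d. \<bar>V x i\<bar>"]) (auto intro: sum_nonneg)
    finally show ?thesis .
  qed
  \<comment> \<open>With this tolerance the \<open>d\<close> coordinates together contribute less
    than \<open>\<delta>\<close>, which gives the final contradiction.\<close>
  have "0 < \<delta> / real (d + 1)" using \<delta> by simp
  then obtain m X where m: "0 < m" and X: "\<forall>i<d. X i \<le> p * m"
    and F: "\<forall>i<d. \<bar>\<Sum>t<m. V (coarsen d m X t) i\<bar> \<le> real m * (\<delta> / real (d + 1))"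
    using inward_field_approx_zero[of p "\<delta> / real (d + 1)" d V B] p B Vlo Vhi by blast
  let ?I = "coarsen d m X ` {..<m}"
  have I: "?I \<subseteq> box_pts d p" using coarsen_in_box_pts[OF X] by auto
  let ?R = "\<lambda>x. P - {z\<in>P. 0 < approach d x (V x) z}"
  have R: "card (?R x) * (d + 1) < card P" if "x \<in> ?I" for x
  proof -
    have "card (?R x) = card P - card {z\<in>P. 0 < approach d x (V x) z}"
      using finP by (intro card_Diff_subset) auto
    moreover have "card {z\<in>P. 0 < approach d x (V x) z} \<le> card P"
      using finP by (intro card_mono) auto
    moreover have "d * card P < card {z\<in>P. 0 < approach d x (V x) z} * (d + 1)"
      using V that I unfolding bad_def by blast
    moreover have "0 < card P" using calculation(2,3) by (cases "card P = 0") auto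
    ultimately show ?thesis
      by (simp add: diff_mult_distrib algebra_simps less_diff_conv2)
  qed
  \<comment> \<open>Union bound: at most \<open>d + 1\<close> vertices, each missing fewer than
    \<open>card P / (d + 1)\<close> candidates, leave one candidate that all of them
    approach.\<close>
  have "(\<Sum>x\<in>?I. card (?R x) * (d + 1)) < (\<Sum>x\<in>?I. card P)"
    using R m by (intro sum_strict_mono) auto
  then have "(\<Sum>x\<in>?I. card (?R x)) * (d + 1) < card ?I * card P"
    by (simp only: sum_distrib_right sum_constant of_nat_id)
  also have "\<dots> \<le> (d + 1) * card P" using card_coarsen_image_le by (intro mult_le_mono1) blast
  finally have "(\<Sum>x\<in>?I. card (?R x)) < card P"
    unfolding mult.commute[of "d + 1"] by (meson mult_less_cancel2)
  then have "card (\<Union>x\<in>?I. ?R x) < card P"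
    using card_UN_le[of ?I ?R] by (simp add: order_le_less_trans)
  then have "(\<Union>x\<in>?I. ?R x) \<noteq> P" by auto
  then obtain z where z: "z \<in> P" "\<And>x. x \<in> ?I \<Longrightarrow> 0 < approach d x (V x) z" by blast
  \<comment> \<open>One sign vector serves all vertices of the simplex: their coordinates are
    \<open>X i div m\<close> or one more, so \<open>z i\<close> lies weakly on the same side of all
    of them. On equality the term \<open>- \<bar>V ?x i\<bar>\<close> is below either choice of
    sign.\<close>
  define s where "s = (\<lambda>i\<in>{..<d}. if X i div m < z i then 1 else -1 :: real)"
  have s: "s \<in> {..<d} \<rightarrow>\<^sub>E {-1, 1}" by (simp add: s_def)
  have t: "\<delta> \<le> (\<Sum>i<d. s i * V (coarsen d m X t) i)" if "t < m" for t
  proof -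
    let ?x = "coarsen d m X t"
    have "0 < approach d ?x (V ?x) z" using z that by auto
    also have "\<dots> \<le> (\<Sum>i<d. s i * V ?x i)"
      unfolding approach_def
    proof (rule sum_mono)
      fix i assume "i \<in> {..<d}"
      then show "(if z i = ?x i then - \<bar>V ?x i\<bar> else if ?x i < z i then V ?x i else - V ?x i)
          \<le> s i * V ?x i"
        using coarsen_bounds[OF that, of i d X] by (auto simp: s_def)
    qed
    finally have pos: "0 < (\<Sum>i<d. s i * V ?x i)" .
    have "?x \<in> box_pts d p" using that I by auto
    then have "(\<Sum>i<d. s i * V ?x i) \<in> D" unfolding D_def using s pos by force
    then show ?thesis unfolding \<delta>_def using finD by simp
  qed
  have "real m * \<delta> = (\<Sum>t<m. \<delta>)" by simp
  also have "\<dots> \<le> (\<Sum>t<m. \<Sum>i<d. s i * V (coarsen d m X t) i)"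
    using t by (intro sum_mono) auto
  also have "\<dots> = (\<Sum>i<d. s i * (\<Sum>t<m. V (coarsen d m X t) i))"
    by (subst sum.swap) (simp add: sum_distrib_left)
  also have "\<dots> \<le> (\<Sum>i<d. real m * (\<delta> / real (d + 1)))"
  proof (rule sum_mono)
    fix i assume i: "i \<in> {..<d}"
    then have "s i = 1 \<or> s i = -1" by (simp add: s_def)
    then show "s i * (\<Sum>t<m. V (coarsen d m X t) i) \<le> real m * (\<delta> / real (d + 1))"
      using F i by (auto simp: abs_le_iff)
  qed
  also have "\<dots> = real m * \<delta> * (real d / real (d + 1))" by simp
  also have "\<dots> < real m * \<delta> * 1"
    using m \<delta> by (intro mult_strict_left_mono) auto
  finally show False by simp
qed

section \<open>Query algorithms\<close>

abbreviation l1_dist :: "nat \<Rightarrow> (nat \<Rightarrow> real) \<Rightarrow> (nat \<Rightarrow> real) \<Rightarrow> real" where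
  "l1_dist d x y \<equiv> l1_norm d (\<lambda>i. x i - y i)"

lemma l1_dist_commute: "l1_dist d x y = l1_dist d y x"
  by (simp add: l1_norm_def abs_minus_commute)

lemma l1_dist_triangle: "l1_dist d x z \<le> l1_dist d x y + l1_dist d y z"
  unfolding l1_norm_def sum.distrib[symmetric] by (intro sum_mono) linarith

lemma cube_coordinate:
  assumes "x \<in> cube d" "i < d"
  shows "x i \<in> {0..1}"
  using PiE_mem[OF assms(1)[unfolded cube_def]] assms(2) by simp

lemma l1_dist_cube_le:
  assumes "x \<in> cube d" "y \<in> cube d"
  shows "l1_dist d x y \<le> real d"
proof -
  have "\<bar>x i - y i\<bar> \<le> 1" if "i < d" for i
  proof -
    have "x i \<in> {0..1}" "y i \<in> {0..1}" using assms that cube_coordinate by blast+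
    then show ?thesis by (auto simp: abs_le_iff)
  qed
  then have "l1_dist d x y \<le> (\<Sum>i<d. 1)"
    unfolding l1_norm_def by (intro sum_mono) auto
  then show ?thesis by simp
qed

lemma grid_subset_cube: "grid d b \<subseteq> cube d"
  by (auto simp: grid_def)

lemma grid_mono:
  assumes "b \<le> c"
  shows "grid d b \<subseteq> grid d c"
proof
  fix x assume x: "x \<in> grid d b"
  have "\<exists>k::nat. k \<le> 2 ^ c \<and> x i = real k / 2 ^ c" if "i < d" for i
  proof -
    obtain k :: nat where k: "k \<le> 2 ^ b" "x i = real k / 2 ^ b"
      using x \<open>i < d\<close> by (auto simp: grid_def)
    have c: "(2::'a::semiring_1) ^ c = 2 ^ b * 2 ^ (c - b)"
      using assms by (simp flip: power_add)
    have "k * 2 ^ (c - b) \<le> 2 ^ c" using k by (simp add: c)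
    moreover have "x i = real (k * 2 ^ (c - b)) / 2 ^ c" using k by (simp add: c)
    ultimately show ?thesis by blast
  qed
  then show "x \<in> grid d c" using x by (auto simp: grid_def)
qed

text \<open>Allows the search to run on the coarsest admissible grid, so that its query count does
  not grow with the given resolution.\<close>

lemma contraction_grid_map_coarser:
  assumes "contraction_grid_map d c lam f" "b \<le> c"
  shows "contraction_grid_map d b lam f"
  using assms(1) grid_mono[OF assms(2), of d] unfolding contraction_grid_map_def by blast

definition grid_pt :: "nat \<Rightarrow> nat \<Rightarrow> (nat \<Rightarrow> nat) \<Rightarrow> nat \<Rightarrow> real" where
  "grid_pt d b k = (\<lambda>i\<in>{..<d}. real (k i) / 2 ^ b)"

lemma grid_pt_in_grid:
  assumes "\<And>i. i < d \<Longrightarrow> k i \<le> 2 ^ b"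
  shows "grid_pt d b k \<in> grid d b"
proof -
  have "real (k i) \<le> 2 ^ b" if "i < d" for i
    using assms[OF that] by (metis of_nat_le_iff of_nat_numeral of_nat_power)
  then show ?thesis
    using assms by (auto simp: grid_pt_def grid_def cube_def)
qed

lemma grid_eq_image: "grid d b = grid_pt d b ` box_pts d (2 ^ b)"
proof
  show "grid d b \<subseteq> grid_pt d b ` box_pts d (2 ^ b)"
  proof
    fix x assume x: "x \<in> grid d b"
    then obtain k :: "nat \<Rightarrow> nat" where k: "\<And>i. i < d \<Longrightarrow> k i \<le> 2 ^ b \<and> x i = real (k i) / 2 ^ b"
      unfolding grid_def by auto metis
    have "x \<in> extensional {..<d}" using x by (simp add: grid_def cube_def PiE_def)
    then have "x = grid_pt d b (restrict k {..<d})"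
      using k by (auto simp: grid_pt_def extensional_def)
    moreover have "restrict k {..<d} \<in> box_pts d (2 ^ b)" using k by (simp add: box_pts_def)
    ultimately show "x \<in> grid_pt d b ` box_pts d (2 ^ b)" by blast
  qed
  show "grid_pt d b ` box_pts d (2 ^ b) \<subseteq> grid d b"
    by (auto simp: box_pts_def intro!: grid_pt_in_grid)
qed

lemma finite_grid: "finite (grid d b)"
  by (simp add: grid_eq_image finite_box_pts)

lemma card_grid_le: "card (grid d b) \<le> 2 ^ ((b + 1) * d)"
proof -
  have "card (grid d b) \<le> card (box_pts d (2 ^ b))"
    unfolding grid_eq_image by (rule card_image_le[OF finite_box_pts])
  also have "\<dots> = (2 ^ b + 1) ^ d" by (simp add: box_pts_def card_PiE)
  also have "\<dots> \<le> (2 ^ (b + 1)) ^ d" by (intro power_mono) auto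
  finally show ?thesis by (simp only: power_mult)
qed

lemma inj_on_grid_pt: "inj_on (grid_pt d b) (box_pts d p)"
proof (rule inj_onI)
  fix k l assume kl: "k \<in> box_pts d p" "l \<in> box_pts d p" "grid_pt d b k = grid_pt d b l"
  show "k = l"
  proof (rule PiE_ext)
    show "k \<in> {..<d} \<rightarrow>\<^sub>E {..p}" "l \<in> {..<d} \<rightarrow>\<^sub>E {..p}" using kl by (auto simp: box_pts_def)
    fix i assume "i \<in> {..<d}"
    then show "k i = l i" using fun_cong[OF kl(3), of i] by (simp add: grid_pt_def)
  qed
qed

text \<open>Convexity of the distance to a fixed point: what a full step gains is at most what the
  one-sided derivative at its start promises.\<close>

lemma l1_dist_diff_le_approach:
  "l1_dist d (grid_pt d b x) (grid_pt d b z) - l1_dist d y (grid_pt d b z)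
     \<le> approach d x (\<lambda>i. y i - grid_pt d b x i) z"
  unfolding l1_norm_def approach_def sum_subtractf[symmetric]
proof (rule sum_mono)
  fix i assume i: "i \<in> {..<d}"
  have "real (x i) / 2 ^ b < real (z i) / 2 ^ b" if "x i < z i"
    using that by (simp add: divide_strict_right_mono)
  moreover have "real (z i) / 2 ^ b < real (x i) / 2 ^ b" if "z i < x i"
    using that by (simp add: divide_strict_right_mono)
  ultimately show "\<bar>grid_pt d b x i - grid_pt d b z i\<bar> - \<bar>y i - grid_pt d b z i\<bar>
      \<le> (if z i = x i then - \<bar>y i - grid_pt d b x i\<bar>
          else if x i < z i then y i - grid_pt d b x i else - (y i - grid_pt d b x i))"
    using i by (cases "x i" "z i" rule: linorder_cases) (auto simp: grid_pt_def)
qed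

section \<open>Search by centerpoints\<close>

definition closer :: "nat \<Rightarrow> (nat \<Rightarrow> real) set \<Rightarrow> (nat \<Rightarrow> real) \<Rightarrow> (nat \<Rightarrow> real) \<Rightarrow> (nat \<Rightarrow> real) set"
  where "closer d P c y = {z\<in>P. l1_dist d y z < l1_dist d c z}"

lemma grid_centerpoint:
  assumes P: "P \<subseteq> grid d b"
  shows "\<exists>c\<in>grid d b. \<forall>y. card (closer d P c y) * (d + 1) \<le> d * card P"
proof -
  obtain K where K: "K \<subseteq> box_pts d (2 ^ b)" "P = grid_pt d b ` K"
    using P unfolding grid_eq_image by (auto simp: subset_image_iff)
  then have finK: "finite K" using finite_box_pts finite_subset by blast
  have inj: "inj_on (grid_pt d b) K" using inj_on_grid_pt K inj_on_subset by blast
  obtain x where x: "x \<in> box_pts d (2 ^ b)"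
    and cx: "\<And>v. card {z\<in>K. 0 < approach d x v z} * (d + 1) \<le> d * card K"
    using l1_centerpoint[OF _ K(1)] by auto
  have "card (closer d P (grid_pt d b x) y) * (d + 1) \<le> d * card P" for y
  proof -
    let ?v = "\<lambda>i. y i - grid_pt d b x i"
    have "closer d P (grid_pt d b x) y \<subseteq> grid_pt d b ` {z\<in>K. 0 < approach d x ?v z}"
    proof
      fix w assume "w \<in> closer d P (grid_pt d b x) y"
      then obtain z where z: "z \<in> K" "w = grid_pt d b z"
        "l1_dist d y (grid_pt d b z) < l1_dist d (grid_pt d b x) (grid_pt d b z)"
        by (auto simp: closer_def K(2))
      then have "0 < approach d x ?v z"
        using l1_dist_diff_le_approach[of d b x z y] by linarith
      then show "w \<in> grid_pt d b ` {z\<in>K. 0 < approach d x ?v z}" using z by blast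
    qed
    then have "card (closer d P (grid_pt d b x) y) \<le> card {z\<in>K. 0 < approach d x ?v z}"
      by (rule surj_card_le[rotated]) (simp add: finK)
    then have "card (closer d P (grid_pt d b x) y) * (d + 1) \<le> d * card K"
      using cx[of ?v] by (meson le_trans mult_le_mono1)
    then show ?thesis using card_image[OF inj] K by simp
  qed
  moreover have "grid_pt d b x \<in> grid d b" using x by (auto simp: grid_eq_image)
  ultimately show ?thesis by blast
qed

text \<open>A choice operator is acceptable here because only queries are counted, not the work
  between them.\<close>

definition center :: "nat \<Rightarrow> nat \<Rightarrow> (nat \<Rightarrow> real) set \<Rightarrow> nat \<Rightarrow> real" where
  "center d b P =
     (SOME c. c \<in> grid d b \<and> (\<forall>y. card (closer d P c y) * (d + 1) \<le> d * card P))"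

lemma center:
  assumes "P \<subseteq> grid d b"
  shows "center d b P \<in> grid d b" "card (closer d P (center d b P) y) * (d + 1) \<le> d * card P"
  using someI_ex[of "\<lambda>c. c \<in> grid d b \<and> (\<forall>y. card (closer d P c y) * (d + 1) \<le> d * card P)"]
    grid_centerpoint[OF assms] unfolding center_def by blast+

text \<open>\<open>P\<close> is the set of grid points still compatible with the answers.\<close>
primrec center_search :: "nat \<Rightarrow> nat \<Rightarrow> real \<Rightarrow> nat \<Rightarrow> (nat \<Rightarrow> real) set
    \<Rightarrow> (nat \<Rightarrow> real, nat \<Rightarrow> real, nat \<Rightarrow> real) query_alg" where
  "center_search d b \<epsilon> 0 P = Output undefined"
| "center_search d b \<epsilon> (Suc n) P = Query (center d b P)
     (\<lambda>y. if l1_dist d y (center d b P) \<le> \<epsilon> then Output (center d b P)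
          else center_search d b \<epsilon> n (closer d P (center d b P) y))"

text \<open>The cardinality hypothesis is the invariant: each failed query shrinks the candidates by
  a factor \<open>d / (d + 1)\<close>, while \<open>z\<close> survives. For \<open>n = 0\<close> it
  would force \<open>P\<close> to be empty, so the output \<open>undefined\<close> is never
  reached.\<close>

lemma center_search_correct:
  assumes "P \<subseteq> grid d b" "z \<in> P"
    and z: "\<And>c. c \<in> grid d b \<Longrightarrow> \<epsilon> < l1_dist d (f c) c \<Longrightarrow> l1_dist d (f c) z < l1_dist d c z"
    and "card P * d ^ n < (d + 1) ^ n"
  shows "set (queries (center_search d b \<epsilon> n P) f) \<subseteq> grid d b \<and>
    result (center_search d b \<epsilon> n P) f \<in> grid d b \<and>
    l1_dist d (f (result (center_search d b \<epsilon> n P) f)) (result (center_search d b \<epsilon> n P) f) \<le> \<epsilon> \<and>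
    length (queries (center_search d b \<epsilon> n P) f) \<le> n"
  using assms(1,2,4)
proof (induction n arbitrary: P)
  case 0
  then have "finite P" using finite_grid finite_subset by blast
  with 0 show ?case by auto
next
  case (Suc n)
  define c where "c = center d b P"
  have c: "c \<in> grid d b" unfolding c_def by (rule center(1)[OF Suc.prems(1)])
  show ?case
  proof (cases "l1_dist d (f c) c \<le> \<epsilon>")
    case True
    then show ?thesis using c by (simp add: c_def[symmetric])
  next
    case False
    let ?P = "closer d P c (f c)"
    have "card ?P * d ^ n * (d + 1) = card ?P * (d + 1) * d ^ n" by (simp only: mult_ac)
    also have "\<dots> \<le> d * card P * d ^ n"
      unfolding c_def by (intro mult_le_mono1 center(2)[OF Suc.prems(1)])
    also have "\<dots> < (d + 1) ^ n * (d + 1)" using Suc.prems(3) by (simp add: mult_ac)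
    finally have "card ?P * d ^ n < (d + 1) ^ n" by (meson mult_less_cancel2)
    moreover have "?P \<subseteq> grid d b" using Suc.prems(1) by (auto simp: closer_def)
    moreover have "z \<in> ?P" using Suc.prems(2) z[OF c] False by (simp add: closer_def)
    ultimately have "set (queries (center_search d b \<epsilon> n ?P) f) \<subseteq> grid d b \<and>
        result (center_search d b \<epsilon> n ?P) f \<in> grid d b \<and>
        l1_dist d (f (result (center_search d b \<epsilon> n ?P) f)) (result (center_search d b \<epsilon> n ?P) f) \<le> \<epsilon> \<and>
        length (queries (center_search d b \<epsilon> n ?P) f) \<le> n"
      by (intro Suc.IH)
    then show ?thesis using False c by (simp add: c_def[symmetric])
  qed
qed

section \<open>Rounding, and a candidate that is never discarded\<close>

definition round_grid :: "nat \<Rightarrow> nat \<Rightarrow> (nat \<Rightarrow> real) \<Rightarrow> nat \<Rightarrow> real" where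
  "round_grid d b x = grid_pt d b (\<lambda>i. nat \<lfloor>x i * 2 ^ b + 1 / 2\<rfloor>)"

lemma round_grid:
  assumes x: "x \<in> cube d"
  shows "round_grid d b x \<in> grid d b" "l1_dist d x (round_grid d b x) \<le> real d / 2 ^ b / 2"
proof -
  have x01: "0 \<le> x i * 2 ^ b" "x i * 2 ^ b \<le> 2 ^ b" if "i < d" for i
  proof -
    have "x i \<in> {0..1}" using cube_coordinate[OF x that] .
    then show "0 \<le> x i * 2 ^ b" "x i * 2 ^ b \<le> 2 ^ b" by auto
  qed
  show "round_grid d b x \<in> grid d b"
    unfolding round_grid_def
  proof (rule grid_pt_in_grid)
    fix i assume "i < d"
    from x01(2)[OF this] have "x i * 2 ^ b + 1 / 2 < of_int (2 ^ b + 1)"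
      unfolding of_int_add of_int_power of_int_numeral of_int_1 by linarith
    then have "\<lfloor>x i * 2 ^ b + 1 / 2\<rfloor> < 2 ^ b + 1" by (simp only: floor_less_iff)
    then show "nat \<lfloor>x i * 2 ^ b + 1 / 2\<rfloor> \<le> 2 ^ b" by simp
  qed
  have "\<bar>x i - round_grid d b x i\<bar> \<le> 1 / 2 ^ b / 2" if i: "i < d" for i
  proof -
    let ?k = "\<lfloor>x i * 2 ^ b + 1 / 2\<rfloor>"
    have k0: "0 \<le> ?k" using x01[OF i] by simp
    have "\<bar>x i * 2 ^ b - of_int ?k\<bar> \<le> 1 / 2" by linarith
    then have "\<bar>x i * 2 ^ b - of_int ?k\<bar> / 2 ^ b \<le> 1 / 2 / 2 ^ b" by (rule divide_right_mono) simp
    moreover have "x i - round_grid d b x i = (x i * 2 ^ b - of_int ?k) / 2 ^ b"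
      using i k0 by (simp add: round_grid_def grid_pt_def diff_divide_distrib)
    ultimately show ?thesis by (simp add: mult.commute)
  qed
  then have "l1_dist d x (round_grid d b x) \<le> (\<Sum>i<d. 1 / 2 ^ b / 2)"
    unfolding l1_norm_def by (intro sum_mono) auto
  then show "l1_dist d x (round_grid d b x) \<le> real d / 2 ^ b / 2" by simp
qed

text \<open>Banach iteration decreases the residual geometrically. Arbitrarily good approximate
  fixpoints suffice below, so no limit is formed.\<close>

lemma contraction_approx_fixpoint:
  assumes f: "f \<in> cube d \<rightarrow> cube d" and lam: "0 \<le> lam" "lam < 1" and \<eta>: "0 < \<eta>"
    and lip: "\<And>x y. x \<in> cube d \<Longrightarrow> y \<in> cube d \<Longrightarrow> l1_dist d (f x) (f y) \<le> lam * l1_dist d x y"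
  obtains x where "x \<in> cube d" "l1_dist d (f x) x \<le> \<eta>"
proof -
  define a where "a n = (f ^^ n) (grid_pt d 0 (\<lambda>_. 0))" for n
  have a: "a n \<in> cube d" for n
  proof (induction n)
    case 0
    have "grid_pt d 0 (\<lambda>_. 0) \<in> grid d 0" by (rule grid_pt_in_grid) simp
    then show ?case using grid_subset_cube by (auto simp: a_def)
  next
    case (Suc n)
    then show ?case using f by (auto simp: a_def)
  qed
  have bound: "l1_dist d (f (a n)) (a n) \<le> lam ^ n * real d" for n
  proof (induction n)
    case 0
    show ?case using l1_dist_cube_le[of "f (a 0)" d "a 0"] a[of 0] f by auto
  next
    case (Suc n)
    have "l1_dist d (f (a (Suc n))) (a (Suc n)) = l1_dist d (f (f (a n))) (f (a n))"
      by (simp add: a_def)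
    also have "\<dots> \<le> lam * l1_dist d (f (a n)) (a n)" using lip a f by blast
    also have "\<dots> \<le> lam * (lam ^ n * real d)" using Suc lam by (intro mult_left_mono) auto
    finally show ?case by (simp add: mult_ac)
  qed
  have "(\<lambda>n. lam ^ n * real d) \<longlonglongrightarrow> 0 * real d"
    by (intro tendsto_intros LIMSEQ_realpow_zero lam)
  then have "eventually (\<lambda>n. lam ^ n * real d < \<eta>) sequentially"
    using \<eta> by (intro order_tendstoD) auto
  then obtain n where "lam ^ n * real d < \<eta>" by (auto simp: eventually_sequentially)
  then show thesis using that[OF a[of n]] bound[of n] by simp
qed

text \<open>A residual above \<open>\<epsilon>\<close> keeps \<open>c\<close> at distance more than
  \<open>(\<epsilon> - \<eta>) / (1 + lam)\<close> from the approximate fixpoint \<open>x\<close>.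
  Contraction then brings \<open>f c\<close> closer to \<open>x\<close> by more than twice the
  rounding error, so the gain persists for the rounded point.\<close>

lemma rounded_fixpoint_survives:
  assumes f: "contraction_grid_map d b lam f" and lam: "0 \<le> lam" "lam < 1" and \<epsilon>: "0 < \<epsilon>"
    and b: "real d / 2 ^ b \<le> \<epsilon> * (1 - lam) / (2 * (1 + lam))"
  obtains z where "z \<in> grid d b"
    "\<And>c. c \<in> grid d b \<Longrightarrow> \<epsilon> < l1_dist d (f c) c \<Longrightarrow> l1_dist d (f c) z < l1_dist d c z"
proof -
  obtain f' where f': "f' \<in> cube d \<rightarrow> cube d"
    and lip: "\<And>x y. x \<in> cube d \<Longrightarrow> y \<in> cube d \<Longrightarrow> l1_dist d (f' x) (f' y) \<le> lam * l1_dist d x y"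
    and ff': "\<And>x. x \<in> grid d b \<Longrightarrow> f x = f' x"
    using f unfolding contraction_grid_map_def by blast
  \<comment> \<open>This balances the budget \<open>\<epsilon> * (1 - lam)\<close>:
    \<open>2 * \<eta>\<close> takes one half, and the rounding error, counted twice and scaled by
    \<open>1 + lam\<close>, at most the other.\<close>
  define \<eta> where "\<eta> = \<epsilon> * (1 - lam) / 4"
  have "0 < \<eta>" using lam \<epsilon> by (simp add: \<eta>_def)
  then obtain x where x: "x \<in> cube d" "l1_dist d (f' x) x \<le> \<eta>"
    using contraction_approx_fixpoint[OF f' lam _ lip] by blast
  let ?z = "round_grid d b x"
  have z: "l1_dist d x ?z \<le> \<epsilon> * (1 - lam) / (4 * (1 + lam))"
  proof -
    have "l1_dist d x ?z \<le> real d / 2 ^ b / 2" by (rule round_grid(2)[OF x(1)])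
    also have "\<dots> \<le> \<epsilon> * (1 - lam) / (2 * (1 + lam)) / 2" by (intro divide_right_mono b) simp
    finally show ?thesis by (simp add: mult.assoc)
  qed
  show thesis
  proof (rule that[OF round_grid(1)[OF x(1)]])
    fix c assume c: "c \<in> grid d b" and far: "\<epsilon> < l1_dist d (f c) c"
    let ?D = "l1_dist d c x"
    have fc: "l1_dist d (f c) x \<le> lam * ?D + \<eta>"
      using l1_dist_triangle[of d "f c" x "f' x"] lip[of c x] ff'[OF c] x c grid_subset_cube[of d b]
      by fastforce
    then have "\<epsilon> < lam * ?D + \<eta> + ?D"
      using far l1_dist_triangle[of d "f c" c x] l1_dist_commute[of d x c] by linarith
    then have "\<epsilon> - \<eta> < (1 + lam) * ?D" by (simp add: algebra_simps)
    then have "(1 - lam) * (\<epsilon> - \<eta>) < (1 - lam) * ((1 + lam) * ?D)"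
      using lam by (intro mult_strict_left_mono) auto
    moreover have "(1 + lam) * \<eta> + 2 * (\<epsilon> * (1 - lam) / 4) \<le> (1 - lam) * (\<epsilon> - \<eta>)"
      by (simp add: \<eta>_def field_simps)
    moreover have "(1 + lam) * l1_dist d x ?z \<le> \<epsilon> * (1 - lam) / 4"
      using z lam by (simp add: field_simps)
    moreover have "(1 + lam) * (\<eta> + 2 * l1_dist d x ?z)
        = (1 + lam) * \<eta> + 2 * ((1 + lam) * l1_dist d x ?z)"
      by (simp add: algebra_simps)
    ultimately have "(1 + lam) * (\<eta> + 2 * l1_dist d x ?z) < (1 - lam) * ((1 + lam) * ?D)"
      by linarith
    also have "\<dots> = (1 + lam) * ((1 - lam) * ?D)" by (rule mult.left_commute)
    finally have "(1 + lam) * (\<eta> + 2 * l1_dist d x ?z) < (1 + lam) * ((1 - lam) * ?D)" .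
    then have "\<eta> + 2 * l1_dist d x ?z < (1 - lam) * ?D"
      using lam by (simp add: mult_less_cancel_left_pos)
    then have "lam * ?D + \<eta> + l1_dist d x ?z < ?D - l1_dist d x ?z" by (simp add: algebra_simps)
    then show "l1_dist d (f c) ?z < l1_dist d c ?z"
      using fc l1_dist_triangle[of d "f c" ?z x] l1_dist_triangle[of d c x ?z]
        l1_dist_commute[of d x ?z] by linarith
  qed
qed

section \<open>Rounded Banach iteration\<close>

primrec rounded_iteration :: "nat \<Rightarrow> nat \<Rightarrow> nat \<Rightarrow> (nat \<Rightarrow> real)
    \<Rightarrow> (nat \<Rightarrow> real, nat \<Rightarrow> real, nat \<Rightarrow> real) query_alg" where
  "rounded_iteration d b 0 x = Output x"
| "rounded_iteration d b (Suc n) x = Query x (\<lambda>y. rounded_iteration d b n (round_grid d b y))"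

text \<open>The residual bound splits into \<open>D\<close>, which contracts, and \<open>E\<close>,
  which absorbs rounding: by the assumption on \<open>E\<close>, \<open>lam * E\<close> plus the new
  rounding error is again at most \<open>E\<close>.\<close>

lemma rounded_iteration_correct:
  assumes f: "contraction_grid_map d b lam f" and lam: "0 \<le> lam"
    and E: "(1 + lam) * (real d / 2 ^ b / 2) \<le> (1 - lam) * E"
    and "x \<in> grid d b" "l1_dist d (f x) x \<le> D + E"
  shows "set (queries (rounded_iteration d b n x) f) \<subseteq> grid d b \<and>
    result (rounded_iteration d b n x) f \<in> grid d b \<and>
    l1_dist d (f (result (rounded_iteration d b n x) f)) (result (rounded_iteration d b n x) f)
      \<le> lam ^ n * D + E \<and>
    length (queries (rounded_iteration d b n x) f) = n"
  using assms(4,5)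
proof (induction n arbitrary: x D)
  case 0
  then show ?case by simp
next
  case (Suc n)
  let ?y = "round_grid d b (f x)" and ?\<rho> = "real d / 2 ^ b / 2"
  have fx: "f x \<in> cube d" using f Suc.prems(1) by (auto simp: contraction_grid_map_def)
  have y: "?y \<in> grid d b" "l1_dist d (f x) ?y \<le> ?\<rho>" using round_grid[OF fx] by auto
  have "l1_dist d (f ?y) (f x) \<le> lam * l1_dist d ?y x"
    using f y(1) Suc.prems(1) grid_subset_cube[of d b] unfolding contraction_grid_map_def by force
  also have "\<dots> \<le> lam * (?\<rho> + (D + E))"
    using y(2) l1_dist_triangle[of d ?y x "f x"] l1_dist_commute[of d "f x" ?y] Suc.prems(2) lam
    by (intro mult_left_mono) linarith+
  finally have "l1_dist d (f ?y) ?y \<le> lam * (?\<rho> + (D + E)) + ?\<rho>"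
    using y(2) l1_dist_triangle[of d "f ?y" ?y "f x"] by linarith
  also have "\<dots> = lam * D + lam * E + (1 + lam) * ?\<rho>" by (simp only: distrib_left distrib_right mult_1 ac_simps)
  also have "\<dots> \<le> lam * D + E" using E unfolding left_diff_distrib by linarith
  finally show ?case
    using Suc.IH[OF y(1), of "lam * D"] Suc.prems(1) by (simp add: mult_ac)
qed

section \<open>Query bounds\<close>

text \<open>By Bernoulli's inequality \<open>(1 + 1 / d) ^ d\<close> is at least 2, so
  \<open>d\<close> queries halve the number of candidates. One extra round of \<open>d\<close>
  queries makes the inequality strict.\<close>

lemma two_power_mult_power_less:
  fixes d N :: nat
  assumes "1 \<le> d"
  shows "2 ^ N * d ^ (d * (N + 1)) < (d + 1) ^ (d * (N + 1))"
proof -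
  have "1 + real d * (1 / real d) \<le> (1 + 1 / real d) ^ d" 
    using assms by (intro Bernoulli_inequality) (simp add: field_simps)
  then have "2 * real d ^ d \<le> (1 + 1 / real d) ^ d * real d ^ d"
    using assms by (intro mult_right_mono) auto
  also have "\<dots> = real (d + 1) ^ d"
    using assms by (simp add: power_mult_distrib[symmetric] field_simps)
  finally have "real (2 * d ^ d) \<le> real ((d + 1) ^ d)" by simp
  then have "2 * d ^ d \<le> (d + 1) ^ d" by (simp only: of_nat_le_iff)
  then have "(2 * d ^ d) ^ (N + 1) \<le> ((d + 1) ^ d) ^ (N + 1)" by (intro power_mono) auto
  then have "2 ^ (N + 1) * d ^ (d * (N + 1)) \<le> (d + 1) ^ (d * (N + 1))"
    by (simp only: power_mult_distrib power_mult)
  moreover have "2 ^ N * d ^ (d * (N + 1)) < 2 ^ (N + 1) * d ^ (d * (N + 1))"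
    using assms by simp
  ultimately show ?thesis by linarith
qed

lemma grid_resolution:
  assumes "real b \<ge> log 2 (2 * real d / \<epsilon> * ((1 + lam) / (1 - lam)))"
    and "1 \<le> d" "0 < \<epsilon>" "0 \<le> lam" "lam < 1"
  shows "real d / 2 ^ b \<le> \<epsilon> * (1 - lam) / (2 * (1 + lam))"
proof -
  have "0 < 2 * real d / \<epsilon> * ((1 + lam) / (1 - lam))" using assms by simp
  then have "2 * real d / \<epsilon> * ((1 + lam) / (1 - lam)) \<le> 2 powr real b"
    using assms(1) by (simp add: log_le_iff)
  then have "2 * real d / \<epsilon> * ((1 + lam) / (1 - lam)) \<le> 2 ^ b" by (simp add: powr_realpow)
  then show ?thesis using assms by (simp add: field_simps)
qed

lemma ln_ratio_le:
  assumes "1 \<le> d" "0 < \<epsilon>"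
  shows "ln (2 * real d / \<epsilon>) \<le> 1 + ln (real d) + max 0 (ln (1 / \<epsilon>))"
proof -
  have "ln (2 * real d / \<epsilon>) = ln 2 + ln (real d) + ln (1 / \<epsilon>)"
    using assms by (simp add: ln_div ln_mult)
  then show ?thesis using ln_le_minus_one[of "2 :: real"] by simp
qed

lemma ln_2_ge_half: "1 / 2 \<le> ln (2::real)"
  using ln_le_minus_one[of "1 / 2 :: real"] by (simp add: ln_div)

lemma ln_inverse_ge:
  assumes "0 < (x::real)"
  shows "1 - x \<le> ln (1 / x)"
  using ln_le_minus_one[OF assms] assms by (simp add: ln_div)

lemma ln_gap_ge_half:
  assumes "1 / 2 \<le> lam" "lam < (1::real)"
  shows "1 / 2 \<le> ln (1 / (1 - lam))"
proof -
  have "ln 2 \<le> ln (1 / (1 - lam))" using assms by (subst ln_le_cancel_iff) (auto simp: field_simps)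
  then show ?thesis using ln_2_ge_half by linarith
qed

text \<open>About \<open>M / l\<close> steps are needed. The term \<open>ln d\<close> in
  \<open>M\<close> and the division by \<open>l\<close> have to be paid for by
  \<open>d\<^sup>2 * L\<close> or by a constant, for a different reason in each range of
  \<open>lam\<close>.\<close>

lemma iteration_count:
  fixes \<epsilon> lam :: real
  assumes d: "1 \<le> d" and \<epsilon>: "0 < \<epsilon>" and lam: "0 \<le> lam" "lam < 1"
    and small: "lam < 1 / 2 \<or> 1 / (1 - lam) < real d"
  obtains n :: nat where "lam ^ n * real d \<le> \<epsilon> / 2"
    "real n \<le> 6 * max 1 ((real d)\<^sup>2 * (max 0 (ln (1 / \<epsilon>)) + ln (1 / (1 - lam))))"
proof (cases "lam = 0")
  case True
  \<comment> \<open>A single step already makes \<open>lam ^ n\<close> vanish;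
    \<open>ln (1 / lam)\<close> would be meaningless here.\<close>
  then show thesis using that[of 1] \<epsilon> by simp
next
  case False
  then have lam0: "0 < lam" using lam by simp
  define E where "E = max 0 (ln (1 / \<epsilon>))"
  define L where "L = ln (1 / (1 - lam))"
  define M where "M = ln (2 * real d / \<epsilon>)"
  define l where "l = ln (1 / lam)"
  define n where "n = nat \<lceil>M / l\<rceil>"
  have M: "M \<le> 1 + ln (real d) + E" unfolding M_def E_def by (rule ln_ratio_le[OF d \<epsilon>])
  have l: "1 - lam \<le> l" unfolding l_def by (rule ln_inverse_ge[OF lam0])
  then have l0: "0 < l" using lam by linarith
  have E0: "0 \<le> E" by (simp add: E_def)
  have L: "lam \<le> L" unfolding L_def using ln_inverse_ge[of "1 - lam"] lam by simp
  have lnd: "0 \<le> ln (real d)" "ln (real d) \<le> real d - 1" using d by (auto intro: ln_le_minus_one)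
  have d2: "1 \<le> (real d)\<^sup>2" "real d \<le> (real d)\<^sup>2" using d by (simp_all add: self_le_power)
  have d2E: "E \<le> (real d)\<^sup>2 * E" using mult_right_mono[OF d2(1) E0] by simp
  have "lam ^ n * real d \<le> \<epsilon> / 2"
  proof -
    have "M / l \<le> real n" unfolding n_def by linarith
    then have "M \<le> real n * l" using l0 by (simp add: pos_divide_le_eq)
    then have "ln (2 * real d / \<epsilon>) \<le> ln ((1 / lam) ^ n)"
      unfolding M_def l_def using lam0 by (simp add: ln_realpow)
    then have "2 * real d / \<epsilon> \<le> (1 / lam) ^ n" using d \<epsilon> lam0 by (subst (asm) ln_le_cancel_iff) auto
    then show ?thesis using \<epsilon> lam0 by (simp add: field_simps power_one_over)
  qed
  moreover have "M / l \<le> 3 + 2 * ((real d)\<^sup>2 * (E + L))"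
  proof (cases "lam < 1 / 2")
    case True
    have l2: "1 / 2 \<le> l" using l True by linarith
    show ?thesis
    proof (cases "lam \<le> 1 / real d")
      case True
      \<comment> \<open>Very small \<open>lam\<close>: one step gains a factor of at least
        \<open>d\<close>, so \<open>ln d\<close> costs only a constant.\<close>
      have "real d \<le> 1 / lam" using True lam0 d by (simp add: field_simps)
      then have "ln (real d) \<le> l" unfolding l_def using d lam0 by (subst ln_le_cancel_iff) auto
      moreover have "E \<le> 2 * E * l" using mult_left_mono[OF l2, of "2 * E"] E0 by simp
      ultimately have "M \<le> 2 * l + l + 2 * E * l" using M l2 by linarith
      also have "\<dots> = (3 + 2 * E) * l" by (simp add: algebra_simps)
      finally have "M / l \<le> 3 + 2 * E" using l0 by (simp add: pos_divide_le_eq)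
      moreover have "0 \<le> (real d)\<^sup>2 * L" using L lam by simp
      ultimately show ?thesis using d2E by (simp add: distrib_left)
    next
      case False
      \<comment> \<open>Now \<open>L \<ge> lam > 1 / d\<close>, so \<open>d\<^sup>2 * L\<close>
        dominates \<open>d\<close> and hence \<open>ln d\<close>.\<close>
      have "1 \<le> real d * lam" using False d by (simp add: field_simps)
      then have "real d * 1 \<le> real d * (real d * lam)" by (intro mult_left_mono) auto
      also have "\<dots> \<le> (real d)\<^sup>2 * L" using L by (simp add: power2_eq_square mult.assoc mult_left_mono)
      finally have dL: "real d \<le> (real d)\<^sup>2 * L" by simp
      have M': "M \<le> real d + E" using M lnd by linarith
      have "(real d + E) * 1 \<le> (real d + E) * (2 * l)" using l2 E0 by (intro mult_left_mono) auto
      then have "M \<le> (2 * (real d + E)) * l" using M' by (simp add: algebra_simps)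
      then have "M / l \<le> 2 * (real d + E)" using l0 by (simp add: pos_divide_le_eq)
      then show ?thesis using d2E dL by (simp add: distrib_left)
    qed
  next
    case False
    then have gap: "1 / (1 - lam) < real d" using small by simp
    have "1 / 2 \<le> L" unfolding L_def using ln_gap_ge_half False lam by simp
    then have dL: "(real d)\<^sup>2 * 1 \<le> (real d)\<^sup>2 * (2 * L)" by (intro mult_left_mono) auto
    \<comment> \<open>Dividing by \<open>l\<close> costs at most a factor \<open>d\<close>, and
      \<open>L \<ge> 1 / 2\<close> makes the resulting \<open>d\<^sup>2\<close> affordable.\<close>
    have "1 \<le> real d * (1 - lam)" using gap lam by (simp add: field_simps)
    also have "\<dots> \<le> real d * l" using l by (intro mult_left_mono) auto
    finally have "(real d + E) * 1 \<le> (real d + E) * (real d * l)"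
      using E0 by (intro mult_left_mono) auto
    then have "M \<le> ((real d + E) * real d) * l" using M lnd by (simp add: mult.assoc)
    then have "M / l \<le> (real d + E) * real d" using l0 by (simp add: pos_divide_le_eq)
    also have "\<dots> = (real d)\<^sup>2 + real d * E" by (simp add: power2_eq_square algebra_simps)
    also have "\<dots> \<le> (real d)\<^sup>2 + (real d)\<^sup>2 * E" using d2(2) E0 by (simp add: mult_right_mono)
    finally have "M / l \<le> (real d)\<^sup>2 + (real d)\<^sup>2 * E" .
    moreover have "0 \<le> (real d)\<^sup>2 * E" using E0 by simp
    ultimately show ?thesis using dL unfolding distrib_left mult.left_commute[of _ 2] by linarith
  qed
  moreover have "0 \<le> (real d)\<^sup>2 * (E + L)" using E0 L lam by simp
  \<comment> \<open>The ceiling turns the constant 3 into 4.\<close>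
  ultimately have "real n \<le> 4 + 2 * ((real d)\<^sup>2 * (E + L))" unfolding n_def by linarith
  also have "\<dots> \<le> 6 * max 1 ((real d)\<^sup>2 * (E + L))" by linarith
  finally show thesis using that \<open>lam ^ n * real d \<le> \<epsilon> / 2\<close> unfolding E_def L_def by blast
qed

text \<open>The assumption \<open>gap\<close> gives \<open>ln d \<le> L\<close>, which removes the
  logarithm of the dimension. The summand 2 anticipates the query count
  \<open>d * ((a + 1) * d + 1)\<close>, which is at most \<open>d\<^sup>2 * (a + 2)\<close>.\<close>

lemma coarse_resolution_le:
  fixes \<epsilon> lam :: real
  assumes d: "1 \<le> d" and \<epsilon>: "0 < \<epsilon>" and lam: "1 / 2 \<le> lam" "lam < 1"
    and gap: "real d \<le> 1 / (1 - lam)"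
  shows "real (nat \<lceil>log 2 (2 * real d / \<epsilon> * ((1 + lam) / (1 - lam)))\<rceil>) + 2
    \<le> 18 * (max 0 (ln (1 / \<epsilon>)) + ln (1 / (1 - lam)))"
proof -
  define E where "E = max 0 (ln (1 / \<epsilon>))"
  define L where "L = ln (1 / (1 - lam))"
  define Q where "Q = 2 * real d / \<epsilon> * ((1 + lam) / (1 - lam))"
  have E0: "0 \<le> E" by (simp add: E_def)
  have L2: "1 / 2 \<le> L" unfolding L_def by (rule ln_gap_ge_half[OF lam])
  have dL: "ln (real d) \<le> L" unfolding L_def using gap d lam by (subst ln_le_cancel_iff) auto
  have "ln (1 + lam) \<le> 1" using ln_le_minus_one[of "1 + lam"] lam by simp
  moreover have "ln Q = ln (2 * real d / \<epsilon>) + (ln (1 + lam) + L)"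
    unfolding Q_def L_def using d \<epsilon> lam by (subst ln_mult) (auto simp: ln_div)
  ultimately have "ln Q \<le> 2 + 2 * L + E"
    using ln_ratio_le[OF d \<epsilon>] dL unfolding E_def by linarith
  also have "\<dots> \<le> (2 * (2 + 2 * L + E)) * ln 2"
    using mult_left_mono[OF ln_2_ge_half, of "2 * (2 + 2 * L + E)"] L2 E0 by (simp add: algebra_simps)
  finally have "log 2 Q \<le> 2 * (2 + 2 * L + E)" by (simp add: log_def pos_divide_le_eq)
  then have "of_int \<lceil>log 2 Q\<rceil> \<le> 2 * (2 + 2 * L + E) + 1" by linarith
  then have "real (nat \<lceil>log 2 Q\<rceil>) \<le> 2 * (2 + 2 * L + E) + 1"
    using L2 E0 by (cases "0 \<le> \<lceil>log 2 Q\<rceil>") simp_all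
  \<comment> \<open>The sum is at most \<open>7 + 4 * L + 2 * E\<close>, and
    \<open>7 \<le> 14 * L\<close>; hence 18.\<close>
  then have "real (nat \<lceil>log 2 Q\<rceil>) + 2 \<le> 18 * (E + L)" using L2 E0 by argo
  then show ?thesis unfolding Q_def E_def L_def .
qed

text \<open>The \<open>max 1\<close> leaves room for constantly many queries where the logarithmic
  terms vanish, as for \<open>lam = 0\<close> and \<open>\<epsilon> \<ge> 1\<close>.\<close>

theorem theorem4p3:
  "\<exists>C::real. C > 0 \<and>
     (\<forall>(d::nat) (b::nat) (\<epsilon>::real) (lam::real).
        d \<ge> 1 \<longrightarrow> b \<ge> 1 \<longrightarrow> \<epsilon> > 0 \<longrightarrow> 0 \<le> lam \<longrightarrow> lam < 1 \<longrightarrow>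
        real b \<ge> log 2 (2 * real d / \<epsilon> * ((1 + lam) / (1 - lam))) \<longrightarrow>
        (\<exists>A :: (nat \<Rightarrow> real, nat \<Rightarrow> real, nat \<Rightarrow> real) query_alg.
           \<forall>f. contraction_grid_map d b lam f \<longrightarrow>
             set (queries A f) \<subseteq> grid d b \<and>
             result A f \<in> grid d b \<and>
             l1_norm d (\<lambda>i. f (result A f) i - result A f i) \<le> \<epsilon> \<and>
             real (length (queries A f)) \<le>
               C * max 1 ((real d)\<^sup>2 * (max 0 (ln (1 / \<epsilon>)) + ln (1 / (1 - lam))))))"
proof (rule exI[of _ 18], intro conjI allI impI)
  fix d b :: nat and \<epsilon> lam :: real
  assume d: "1 \<le> d" and \<epsilon>: "0 < \<epsilon>" and lam: "0 \<le> lam" "lam < 1"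
    and b: "log 2 (2 * real d / \<epsilon> * ((1 + lam) / (1 - lam))) \<le> real b"
  let ?K = "(real d)\<^sup>2 * (max 0 (ln (1 / \<epsilon>)) + ln (1 / (1 - lam)))"
  show "\<exists>A :: (nat \<Rightarrow> real, nat \<Rightarrow> real, nat \<Rightarrow> real) query_alg.
      \<forall>f. contraction_grid_map d b lam f \<longrightarrow>
        set (queries A f) \<subseteq> grid d b \<and> result A f \<in> grid d b \<and>
        l1_dist d (f (result A f)) (result A f) \<le> \<epsilon> \<and>
        real (length (queries A f)) \<le> 18 * max 1 ?K"
  proof (cases "lam < 1 / 2 \<or> 1 / (1 - lam) < real d")
    case True
    obtain n where n: "lam ^ n * real d \<le> \<epsilon> / 2" "real n \<le> 6 * max 1 ?K"
      by (rule iteration_count[OF d \<epsilon> lam True])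
    let ?o = "grid_pt d b (\<lambda>_. 0)"
    have o: "?o \<in> grid d b" by (rule grid_pt_in_grid) simp
    \<comment> \<open>Half of \<open>\<epsilon>\<close> is reserved for rounding, the other half for
      \<open>lam ^ n * d\<close>.\<close>
    have res: "(1 + lam) * (real d / 2 ^ b / 2) \<le> (1 - lam) * (\<epsilon> / 2)"
    proof -
      have "(1 + lam) * (real d / 2 ^ b) \<le> (1 + lam) * (\<epsilon> * (1 - lam) / (2 * (1 + lam)))"
        using grid_resolution[OF b d \<epsilon> lam] lam by (intro mult_left_mono) auto
      also have "\<dots> = (1 - lam) * (\<epsilon> / 2)" using lam by (simp add: field_simps)
      finally have "(1 + lam) * (real d / 2 ^ b) \<le> (1 - lam) * (\<epsilon> / 2)" .
      moreover have "0 \<le> (1 + lam) * (real d / 2 ^ b)" using lam by simp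
      moreover have "(1 + lam) * (real d / 2 ^ b / 2) = (1 + lam) * (real d / 2 ^ b) / 2" by simp
      ultimately show ?thesis by argo
    qed
    show ?thesis
    proof (intro exI[of _ "rounded_iteration d b n ?o"] allI impI)
      fix f assume f: "contraction_grid_map d b lam f"
      then have "f ?o \<in> cube d" using o by (auto simp: contraction_grid_map_def)
      then have "l1_dist d (f ?o) ?o \<le> real d"
        using o grid_subset_cube by (blast intro: l1_dist_cube_le)
      then have "l1_dist d (f ?o) ?o \<le> real d + \<epsilon> / 2" using \<epsilon> by linarith
      note it = rounded_iteration_correct[OF f lam(1) res o this, of n]
      then have "l1_dist d (f (result (rounded_iteration d b n ?o) f))
          (result (rounded_iteration d b n ?o) f) \<le> \<epsilon>"
        using n(1) by linarith
      moreover have "real n \<le> 18 * max 1 ?K" using n(2) by linarith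
      ultimately show "set (queries (rounded_iteration d b n ?o) f) \<subseteq> grid d b \<and>
          result (rounded_iteration d b n ?o) f \<in> grid d b \<and>
          l1_dist d (f (result (rounded_iteration d b n ?o) f))
            (result (rounded_iteration d b n ?o) f) \<le> \<epsilon> \<and>
          real (length (queries (rounded_iteration d b n ?o) f)) \<le> 18 * max 1 ?K"
        using it by simp
    qed
  next
    case False
    define a where "a = nat \<lceil>log 2 (2 * real d / \<epsilon> * ((1 + lam) / (1 - lam)))\<rceil>"
    \<comment> \<open>The grid has at most \<open>2 ^ ((a + 1) * d)\<close> points, and every
      \<open>d\<close> queries halve the candidates.\<close>
    define n where "n = d * ((a + 1) * d + 1)"
    have ab: "a \<le> b" unfolding a_def using b by (simp add: nat_le_iff ceiling_le_iff)
    have "log 2 (2 * real d / \<epsilon> * ((1 + lam) / (1 - lam))) \<le> real a" unfolding a_def by linarith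
    note res = grid_resolution[OF this d \<epsilon> lam]
    have small: "card (grid d a) * d ^ n < (d + 1) ^ n"
      using two_power_mult_power_less[OF d, of "(a + 1) * d"] card_grid_le[of d a]
      unfolding n_def by (meson le_less_trans mult_le_mono1)
    have "real a + 2 \<le> 18 * (max 0 (ln (1 / \<epsilon>)) + ln (1 / (1 - lam)))"
      unfolding a_def using coarse_resolution_le[OF d \<epsilon> _ lam(2)] False by simp
    then have "(real d)\<^sup>2 * (real a + 2) \<le> (real d)\<^sup>2 * (18 * (max 0 (ln (1 / \<epsilon>)) + ln (1 / (1 - lam))))"
      by (intro mult_left_mono) auto
    moreover have "real n \<le> (real d)\<^sup>2 * (real a + 2)"
      using d by (simp add: n_def power2_eq_square algebra_simps)
    ultimately have "real n \<le> 18 * ?K" unfolding mult.left_commute[of _ 18] by linarith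
    then have n: "real n \<le> 18 * max 1 ?K" by linarith
    show ?thesis
    proof (intro exI[of _ "center_search d a \<epsilon> n (grid d a)"] allI impI)
      fix f assume "contraction_grid_map d b lam f"
      then have "contraction_grid_map d a lam f" using ab by (rule contraction_grid_map_coarser)
      \<comment> \<open>The point \<open>z\<close> depends on \<open>f\<close> but enters the
        analysis only; the decision tree was fixed before.\<close>
      then obtain z where z: "z \<in> grid d a"
        and closer: "\<And>c. c \<in> grid d a \<Longrightarrow> \<epsilon> < l1_dist d (f c) c \<Longrightarrow> l1_dist d (f c) z < l1_dist d c z"
        using rounded_fixpoint_survives[OF _ lam \<epsilon> res] by blast
      from center_search_correct[where f = f and \<epsilon> = \<epsilon>, OF subset_refl z _ small] closer
      have "set (queries (center_search d a \<epsilon> n (grid d a)) f) \<subseteq> grid d a \<and>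
          result (center_search d a \<epsilon> n (grid d a)) f \<in> grid d a \<and>
          l1_dist d (f (result (center_search d a \<epsilon> n (grid d a)) f))
            (result (center_search d a \<epsilon> n (grid d a)) f) \<le> \<epsilon> \<and>
          length (queries (center_search d a \<epsilon> n (grid d a)) f) \<le> n"
        by blast
      then show "set (queries (center_search d a \<epsilon> n (grid d a)) f) \<subseteq> grid d b \<and>
          result (center_search d a \<epsilon> n (grid d a)) f \<in> grid d b \<and>
          l1_dist d (f (result (center_search d a \<epsilon> n (grid d a)) f))
            (result (center_search d a \<epsilon> n (grid d a)) f) \<le> \<epsilon> \<and>
          real (length (queries (center_search d a \<epsilon> n (grid d a)) f)) \<le> 18 * max 1 ?K"
        using grid_mono[OF ab, of d] n
        by (meson of_nat_le_iff order_trans subsetD)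
    qed
  qed
qed simp

end
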